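(* Let $n\ge 0$. For a Catalan tableau $T$ of index $n+1$, let $\omega$ be the lattice path of length $n$ given by the profile $\pi(T)$, and let $\eta$ be defined as follows. Colour a cell of $T$ if it lies above the $1$ of its column, and also colour every cell lying to the right, in the same row, of a cell coloured in this way; call a cell white if it contains a $0$ and is not coloured. For each column of $T$, let $w$ be its number of white cells, and draw in that column a horizontal unit edge at distance $w$ below the upper border of the column (the upper border being the East step of $\omega$ in that column). Then these horizontal edges can be joined by vertical North steps into a unique path $\eta$ of North and East steps with the same endpoints as $\omega$; the path $\eta$ lies below $\omega$; and the map $T\mapsto(\omega,\eta)$ is a bijection from the set of Catalan tableaux of index $n+1$ onto the set of pairs $(\omega,\eta)$ of paths of length $n$ with North and East unit steps having the same starting point and the same ending point, with $\eta$ below $\omega$. In particular, this bijection sends $T$ to a pair whose upper path $\omega$ is the profile of $T$.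
   Context: **Catalan tableaux.** A Ferrers diagram $F_\lambda$ of a partition $\lambda=(\lambda_1\ge\lambda_2\ge\cdots\ge\lambda_k\ge 0)$ is drawn right-justified with rows written from bottom to top: the $i$-th row from the bottom has $\lambda_i$ cells (zero rows are allowed). A Catalan tableau of index $m$ consists of some $k$ with $0\le k\le m$, a diagram $F_\lambda$ contained in a $k\times(m-k)$ rectangle ($k$ rows, $m-k$ columns) and placed in its bottom-right corner, and a filling of the cells of $F_\lambda$ with $0$'s and $1$'s such that (i) each of the $m-k$ columns of the rectangle contains exactly one $1$; (ii) there is no $0$ which has both a $1$ below it in the same column and a $1$ to its right in the same row. **Profile.** The North-West border of the tableau, read from the South-West corner to the North-East corner of the rectangle, is a lattice path of $m$ unit steps N (north) and E (east), whose first step is always N when $m\ge1$. The profile $\pi(T)$ is the path of $m-1$ steps obtained by deleting this first step; it starts one unit above the South-West corner of the rectangle. **Pairs of paths.** Pairs of paths are considered up to simultaneous translation. "$\eta$ is below $\omega$" means weakly below: $\eta$ may touch $\omega$ but never crosses it. *)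

theory Defs
  imports Main "HOL-Library.FuncSet"
begin

text \<open>
  The SW corner of the rectangle is the point \<open>(0,0)\<close>. The cell \<open>(c, r)\<close> is the unit square
  whose SW corner is the point \<open>(c, r)\<close>; thus columns are numbered from left to right and rows
  from bottom to top, both starting with 0. The number of rows of the rectangle is the length of
  the list \<open>shape\<close>, which may contain zeros, and its number of columns is \<open>ncols\<close>.
\<close>

record tableau =
  ncols :: nat
  shape :: "nat list"
  filling :: "nat \<times> nat \<Rightarrow> nat"

definition cells :: "tableau \<Rightarrow> (nat \<times> nat) set" where
  "cells T = {(c, r). r < length (shape T) \<and> c < ncols T \<and> ncols T - shape T ! r \<le> c}"

definition has_entry :: "tableau \<Rightarrow> nat \<Rightarrow> nat \<times> nat \<Rightarrow> bool" where
  "has_entry T a p \<longleftrightarrow> p \<in> cells T \<and> filling T p = a"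

text \<open>
  Fillings are functions on the cells only (the extensional function space fixes the value
  elsewhere), so that equality of records is equality of tableaux.
\<close>

definition catalan_tableau :: "tableau \<Rightarrow> bool" where
  "catalan_tableau T \<longleftrightarrow>
     sorted_wrt (\<ge>) (shape T) \<and>
     (\<forall>l \<in> set (shape T). l \<le> ncols T) \<and>
     filling T \<in> cells T \<rightarrow>\<^sub>E {0, 1} \<and>
     (\<forall>c < ncols T. \<exists>!r. has_entry T 1 (c, r)) \<and>
     \<not> (\<exists>c r. has_entry T 0 (c, r) \<and>
              (\<exists>r' < r. has_entry T 1 (c, r')) \<and> (\<exists>c' > c. has_entry T 1 (c', r)))"

definition catalan_tableaux :: "nat \<Rightarrow> tableau set" where
  "catalan_tableaux m = {T. catalan_tableau T \<and> length (shape T) + ncols T = m}"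

datatype step = North | East

text \<open>
  A path is given by its word of steps together with a separately specified starting point.
\<close>

type_synonym path = "step list"

fun path_end :: "nat \<times> nat \<Rightarrow> path \<Rightarrow> nat \<times> nat" where
  "path_end p [] = p"
| "path_end (x, y) (North # s) = path_end (x, Suc y) s"
| "path_end (x, y) (East # s) = path_end (Suc x, y) s"

fun vertices :: "nat \<times> nat \<Rightarrow> path \<Rightarrow> (nat \<times> nat) set" where
  "vertices p [] = {p}"
| "vertices (x, y) (North # s) = insert (x, y) (vertices (x, Suc y) s)"
| "vertices (x, y) (East # s) = insert (x, y) (vertices (Suc x, y) s)"

text \<open>An East edge is represented by its left endpoint.\<close>

fun east_edges :: "nat \<times> nat \<Rightarrow> path \<Rightarrow> (nat \<times> nat) set" where
  "east_edges p [] = {}"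
| "east_edges (x, y) (North # s) = east_edges (x, Suc y) s"
| "east_edges (x, y) (East # s) = insert (x, y) (east_edges (Suc x, y) s)"

text \<open>
  Weakly below, for paths with common starting point (placed at the origin, which is immaterial by
  translation invariance) and common ending point: every lattice point of \<open>\<eta>\<close> lies on
  \<open>\<omega>\<close> or vertically beneath a lattice point of \<open>\<omega>\<close>.
\<close>

definition below :: "path \<Rightarrow> path \<Rightarrow> bool" where
  "below \<eta> \<omega> \<longleftrightarrow>
     (\<forall>(x, y) \<in> vertices (0, 0) \<eta>. \<exists>y' \<ge> y. (x, y') \<in> vertices (0, 0) \<omega>)"

text \<open>
  Up to simultaneous translation, a pair of paths with a common starting point is a pair of words.
\<close>

definition path_pairs :: "nat \<Rightarrow> (path \<times> path) set" where
  "path_pairs n = {(\<omega>, \<eta>). length \<omega> = n \<and> length \<eta> = n \<and>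
     path_end (0, 0) \<omega> = path_end (0, 0) \<eta> \<and> below \<eta> \<omega>}"

text \<open>
  \<open>nw_border w ls\<close> is the NW border of the right-justified rows \<open>ls\<close> (listed from bottom to
  top), read from the SW to the NE corner of the rectangle with \<open>w\<close> columns enclosing them: the
  path first passes over the columns not met by the bottom row, climbs along that row, and then
  continues over the columns of that row.
\<close>

fun nw_border :: "nat \<Rightarrow> nat list \<Rightarrow> path" where
  "nw_border w [] = replicate w East"
| "nw_border w (l # ls) = replicate (w - l) East @ North # nw_border l ls"

text \<open>
  The first step of the border of a Catalan tableau of positive index is \<open>North\<close>, as no column
  is empty; without it, the border starts at the point \<open>(0,1)\<close>.
\<close>

definition profile :: "tableau \<Rightarrow> path" where
  "profile T = tl (nw_border (ncols T) (shape T))"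

definition coloured_cells :: "tableau \<Rightarrow> (nat \<times> nat) set" where
  "coloured_cells T = {(c, r). (c, r) \<in> cells T \<and>
     (\<exists>c' \<le> c. (c', r) \<in> cells T \<and> (\<exists>r' < r. has_entry T 1 (c', r')))}"

definition white_cells :: "tableau \<Rightarrow> (nat \<times> nat) set" where
  "white_cells T = {p. has_entry T 0 p \<and> p \<notin> coloured_cells T}"

definition num_white :: "tableau \<Rightarrow> nat \<Rightarrow> nat" where
  "num_white T c = card {r. (c, r) \<in> white_cells T}"

definition drawn_edges :: "tableau \<Rightarrow> (nat \<times> nat) set" where
  "drawn_edges T = {(c, y). c < ncols T \<and> (c, y + num_white T c) \<in> east_edges (0, 1) (profile T)}"

definition joins_drawn_edges :: "tableau \<Rightarrow> path \<Rightarrow> bool" where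
  "joins_drawn_edges T \<eta> \<longleftrightarrow>
     path_end (0, 1) \<eta> = path_end (0, 1) (profile T) \<and> east_edges (0, 1) \<eta> = drawn_edges T"

definition lower_path :: "tableau \<Rightarrow> path" where
  "lower_path T = (THE \<eta>. joins_drawn_edges T \<eta>)"

definition tableau_to_paths :: "tableau \<Rightarrow> path \<times> path" where
  "tableau_to_paths T = (profile T, lower_path T)"

end

theory Submission
  imports Defs
begin

text \<open>
  Let \<open>h c\<close> be the height of column \<open>c\<close> of the diagram and \<open>p c\<close> the row of the 1 in that
  column. Condition (ii) says that for \<open>c < c'\<close> either \<open>p c' \<le> p c\<close>, or row \<open>p c'\<close> does not
  reach column \<open>c\<close>, i.e. \<open>h c \<le> p c'\<close>. In other words, no 1 stands on a coloured cell. So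
  the 1 of a column stands on an uncoloured cell, it colours everything above it, and a row
  once coloured stays coloured to the right.

  Let \<open>U c\<close> be the set of rows that are uncoloured in column \<open>c\<close>. When column \<open>c + 1\<close> is
  entered, the rows still available are \<open>U c\<close> and the new rows from \<open>h c\<close> up to
  \<open>h (c + 1) - 1\<close>; the 1 may be put on any of them, and \<open>U (c + 1)\<close> is the initial segment
  of the available rows that ends with \<open>p (c + 1)\<close>. The white cells of a column are its
  uncoloured cells except the 1, so column \<open>c\<close> has \<open>w c = |U c| - 1\<close> of them. A nonempty
  initial segment of a finite set of numbers is determined by its size, which can be any number
  from 1 to the size of the set. Hence a filling corresponds to a sequence \<open>w\<close> with
  \<open>0 \<le> w c < h c\<close> and \<open>w (c + 1) \<le> w c + h (c + 1) - h c\<close>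
  (\<open>open_rows_unique\<close>, \<open>open_rows_exist\<close>). The second inequality says that
  \<open>h c - w c\<close> is weakly increasing, the first that it lies between 1 and \<open>h c\<close>. These
  numbers are the heights of the drawn edges, so such sequences are the paths from \<open>(0, 1)\<close>
  that lie weakly below the profile and have the same end.

  Two encodings reduce everything to this. A path is given by the sequence of its top heights in
  the successive columns (\<open>tops\<close>), which turns \<open>east_edges\<close> and \<open>below\<close> into statements
  about weakly increasing sequences. A Catalan tableau is given by its profile together with
  \<open>p\<close> (\<open>tableau_of\<close>, \<open>catalan_tableau_is_tableau_of\<close>).
\<close>

section \<open>Lattice paths as sequences of column tops\<close>

text \<open>
  The list has one entry more than there are East steps: the entries are the heights of the East
  edges followed by the height of the end point. With this last entry the list determines the
  word, and its entry for a column is the height of the topmost path vertex with that abscissa.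
\<close>

fun tops :: "nat \<Rightarrow> path \<Rightarrow> nat list" where
  "tops y [] = [y]"
| "tops y (North # s) = tops (Suc y) s"
| "tops y (East # s) = y # tops y s"

lemma length_tops: "length (tops y s) = Suc (count_list s East)"
  by (induction y s rule: tops.induct) auto

lemma tops_not_Nil [simp]: "tops y s \<noteq> []"
  using length_tops[of y s] by auto

lemma path_end_eq: "path_end (x, y) s = (x + count_list s East, last (tops y s))"
  by (induction y s arbitrary: x rule: tops.induct) auto

lemma length_path: "length s + y = count_list s East + last (tops y s)"
  by (induction y s rule: tops.induct) auto

lemma tops_ge: "t \<in> set (tops y s) \<Longrightarrow> y \<le> t"
  by (induction y s rule: tops.induct) auto

lemma sorted_tops: "sorted (tops y s)"
  by (induction y s rule: tops.induct) (auto dest: tops_ge)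

lemma tops_Suc: "tops (Suc y) s = map Suc (tops y s)"
  by (induction y s rule: tops.induct) auto

lemma tops_replicate_North: "tops y (replicate k North @ s) = tops (y + k) s"
  by (induction k arbitrary: y) auto

text \<open>
  A word starting with North has all its tops above \<open>y\<close>, one starting with East has first top
  \<open>y\<close>, and the empty word has length one; so the first step can be read off the list.
\<close>

lemma tops_inj: "tops y s = tops y s' \<Longrightarrow> s = s'"
proof (induction y s arbitrary: s' rule: tops.induct)
  have ne: "tops (Suc y) t \<noteq> y # ts" for y t ts
    using tops_ge[of y "Suc y" t] by auto
  case (1 y)
  then show ?case
    using ne[of y _ "[]"] by (cases "(y, s')" rule: tops.cases) (auto dest: sym)
next
  have ne: "tops (Suc y) t \<noteq> y # ts" for y t ts
    using tops_ge[of y "Suc y" t] by auto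
  case (2 y s)
  then show ?case
    using ne by (cases "(y, s')" rule: tops.cases) auto
next
  have ne: "tops (Suc y) t \<noteq> y # ts" for y t ts
    using tops_ge[of y "Suc y" t] by auto
  case (3 y s)
  then show ?case
    using ne[of y _ "tops y s"] by (cases "(y, s')" rule: tops.cases) (auto dest: sym)
qed

lemma tops_surj:
  assumes "ts \<noteq> []" "sorted ts" "\<And>t. t \<in> set ts \<Longrightarrow> y \<le> t"
  shows "\<exists>s. tops y s = ts"
  using assms
proof (induction ts arbitrary: y rule: list_nonempty_induct)
  case (single a)
  then show ?case
    using tops_replicate_North[of y "a - y" "[]"] by (intro exI[of _ "replicate (a - y) North"]) simp
next
  case (cons a ts)
  then obtain s where "tops a s = ts" by fastforce
  with cons.prems show ?case
    by (intro exI[of _ "replicate (a - y) North @ East # s"]) (simp add: tops_replicate_North)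
qed

lemma east_edges_eq:
  "east_edges (x, y) s = {(x + i, tops y s ! i) | i. i < count_list s East}"
proof (induction y s arbitrary: x rule: tops.induct)
  case (3 y s)
  have "{(x + i, tops y (East # s) ! i) | i. i < Suc k} =
      insert (x, y) {(Suc x + i, tops y s ! i) | i. i < k}" for k
  proof -
    have "{f i | i. i < Suc k} = insert (f 0) {f (Suc i) | i. i < k}" for f :: "nat \<Rightarrow> nat \<times> nat"
      using less_Suc_eq_0_disj by auto
    from this[of "\<lambda>i. (x + i, tops y (East # s) ! i)"] show ?thesis by simp
  qed
  with 3 show ?case by simp
qed auto

lemma vertices_le_tops:
  "(a, b) \<in> vertices (x, y) s \<Longrightarrow> x \<le> a \<and> a - x \<le> count_list s East \<and> b \<le> tops y s ! (a - x)"
proof (induction y s arbitrary: x rule: tops.induct)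
  case (2 y s)
  have "tops (Suc y) s ! 0 \<in> set (tops (Suc y) s)" by (simp add: length_tops)
  then have "y \<le> tops (Suc y) s ! 0" using tops_ge Suc_leD by blast
  with 2 show ?case by auto
next
  case (3 y s)
  show ?case
  proof (cases "(a, b) = (x, y)")
    case False
    with 3 have "Suc x \<le> a \<and> a - Suc x \<le> count_list s East \<and> b \<le> tops y s ! (a - Suc x)" by auto
    moreover from this have "a - x = Suc (a - Suc x)" by linarith
    ultimately show ?thesis by simp
  qed simp
qed auto

lemma tops_in_vertices:
  "i \<le> count_list s East \<Longrightarrow> (x + i, tops y s ! i) \<in> vertices (x, y) s"
proof (induction y s arbitrary: x i rule: tops.induct)
  case (3 y s)
  then show ?case using "3.IH"[of "i - 1" "Suc x"] by (cases i) auto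
qed auto

text \<open>
  A vertex of \<open>\<eta>\<close> lies beneath some vertex of \<open>\<omega>\<close> iff it lies beneath the topmost one
  with the same abscissa, and it suffices to test this for the topmost vertices of \<open>\<eta>\<close>. The
  paths are compared at starting height 1, where the profile starts, instead of 0; both sides
  then move by one unit.
\<close>

lemma below_iff_tops:
  assumes "count_list \<eta> East = count_list \<omega> East"
  shows "below \<eta> \<omega> \<longleftrightarrow> (\<forall>i \<le> count_list \<omega> East. tops 1 \<eta> ! i \<le> tops 1 \<omega> ! i)"
proof -
  have "below \<eta> \<omega> \<longleftrightarrow> (\<forall>i \<le> count_list \<omega> East. tops 0 \<eta> ! i \<le> tops 0 \<omega> ! i)"
  proof
    assume b: "below \<eta> \<omega>"
    show "\<forall>i \<le> count_list \<omega> East. tops 0 \<eta> ! i \<le> tops 0 \<omega> ! i"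
    proof (intro allI impI)
      fix i assume "i \<le> count_list \<omega> East"
      then have "(i, tops 0 \<eta> ! i) \<in> vertices (0, 0) \<eta>"
        using tops_in_vertices[of i \<eta> 0 0] assms by simp
      with b obtain y' where "tops 0 \<eta> ! i \<le> y'" "(i, y') \<in> vertices (0, 0) \<omega>"
        unfolding below_def by blast
      then show "tops 0 \<eta> ! i \<le> tops 0 \<omega> ! i"
        using vertices_le_tops[of i y' 0 0 \<omega>] by simp
    qed
  next
    assume le: "\<forall>i \<le> count_list \<omega> East. tops 0 \<eta> ! i \<le> tops 0 \<omega> ! i"
    show "below \<eta> \<omega>"
      unfolding below_def
    proof clarify
      fix x y assume "(x, y) \<in> vertices (0, 0) \<eta>"
      then have "x \<le> count_list \<omega> East" "y \<le> tops 0 \<eta> ! x"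
        using vertices_le_tops[of x y 0 0 \<eta>] assms by auto
      then show "\<exists>y'\<ge>y. (x, y') \<in> vertices (0, 0) \<omega>"
        using le tops_in_vertices[of x \<omega> 0 0] by (metis add_0 le_trans)
    qed
  qed
  then show ?thesis
    using assms by (simp add: tops_Suc length_tops)
qed


section \<open>Shapes and their borders\<close>

text \<open>
  Inverse of \<open>nw_border\<close>: the row climbed by a North step extends over the columns whose East
  step comes later.
\<close>

fun rows :: "path \<Rightarrow> nat list" where
  "rows [] = []"
| "rows (East # s) = rows s"
| "rows (North # s) = count_list s East # rows s"

lemma rows_le: "l \<in> set (rows s) \<Longrightarrow> l \<le> count_list s East"
  by (induction s rule: rows.induct) auto

lemma sorted_rows: "sorted_wrt (\<ge>) (rows s)"
  by (induction s rule: rows.induct) (auto dest: rows_le)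

lemma length_rows: "length (rows s) + count_list s East = length s"
  by (induction s rule: rows.induct) auto

lemma nw_border_Suc:
  assumes "\<And>l. l \<in> set ls \<Longrightarrow> l \<le> w"
  shows "nw_border (Suc w) ls = East # nw_border w ls"
  using assms by (cases ls) (auto simp: Suc_diff_le)

lemma nw_border_rows: "nw_border (count_list s East) (rows s) = s"
  by (induction s rule: rows.induct) (auto simp: nw_border_Suc rows_le)

lemma rows_replicate_East: "rows (replicate k East @ s) = rows s"
  by (induction k) auto

lemma count_list_replicate: "count_list (replicate k a @ s) a = k + count_list s a"
  by (induction k) auto

lemma rows_nw_border:
  assumes "sorted_wrt (\<ge>) ls" "\<And>l. l \<in> set ls \<Longrightarrow> l \<le> w"
  shows "rows (nw_border w ls) = ls \<and> count_list (nw_border w ls) East = w"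
  using assms
proof (induction ls arbitrary: w)
  case Nil
  then show ?case
    using rows_replicate_East[of w "[]"] count_list_replicate[of w East "[]"] by simp
next
  case (Cons l ls)
  then have "rows (nw_border l ls) = ls \<and> count_list (nw_border l ls) East = l" "l \<le> w"
    by simp_all
  then show ?case
    by (simp add: rows_replicate_East count_list_replicate del: count_list_append)
qed

text \<open>
  The number of cells in a column, which is defined through the rows, is the height of the border
  over that column.
\<close>

lemma less_tops_iff:
  "c < count_list s East \<Longrightarrow>
     y + r < tops y s ! c \<longleftrightarrow> r < length (rows s) \<and> count_list s East - rows s ! r \<le> c"
proof (induction y s arbitrary: r c rule: tops.induct)
  case (2 y s)
  show ?case
  proof (cases r)
    case 0
    have "tops (Suc y) s ! c \<in> set (tops (Suc y) s)" using 2 by (simp add: length_tops)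
    then show ?thesis using 0 tops_ge by fastforce
  next
    case (Suc r')
    with 2 show ?thesis by simp
  qed
next
  case (3 y s)
  show ?case
  proof (cases c)
    case 0
    have "rows s ! r \<le> count_list s East" if "r < length (rows s)"
      using that rows_le nth_mem by blast
    then show ?thesis using 0 by auto
  next
    case (Suc c')
    have "count_list (East # s) East - rows s ! r = Suc (count_list s East - rows s ! r)"
      if "r < length (rows s)"
      using that rows_le[of "rows s ! r" s] by (simp add: Suc_diff_le)
    with 3 Suc show ?thesis by auto
  qed
qed simp


section \<open>The rows of the ones and the uncoloured rows\<close>

text \<open>
  The conditions on a tableau with \<open>C\<close> columns of heights \<open>h c\<close>, expressed by the rows
  \<open>p c\<close> of its 1's: the 1 lies in the diagram, and condition (ii) holds.
\<close>

definition admissible :: "nat \<Rightarrow> (nat \<Rightarrow> nat) \<Rightarrow> (nat \<Rightarrow> nat) \<Rightarrow> bool" where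
  "admissible C h p \<longleftrightarrow> (\<forall>c < C. p c < h c) \<and>
     (\<forall>c c'. c < c' \<longrightarrow> c' < C \<longrightarrow> p c' \<le> p c \<or> h c \<le> p c')"

definition uncoloured :: "(nat \<Rightarrow> nat) \<Rightarrow> (nat \<Rightarrow> nat) \<Rightarrow> nat \<Rightarrow> nat set" where
  "uncoloured h p c = {r. r < h c \<and> (\<forall>c' \<le> c. r \<le> p c' \<or> h c' \<le> r)}"

lemma finite_uncoloured [simp]: "finite (uncoloured h p c)"
  unfolding uncoloured_def by simp

lemma mem_uncoloured:
  assumes "admissible C h p" "c < C"
  shows "p c \<in> uncoloured h p c"
  using assms unfolding admissible_def uncoloured_def by (auto simp: le_less)

lemma uncoloured_0: "uncoloured h p 0 = {r \<in> {0..<h 0}. r \<le> p 0}"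
  unfolding uncoloured_def by auto

text \<open>
  Colour spreads along a row to the right for good, so only the cells above the new 1 are lost,
  and only the rows that begin in the new column are gained.
\<close>

lemma uncoloured_Suc:
  assumes "h c \<le> h (Suc c)" "\<And>c'. c' \<le> c \<Longrightarrow> h c' \<le> h c"
  shows "uncoloured h p (Suc c) =
    {r \<in> uncoloured h p c \<union> {h c..<h (Suc c)}. r \<le> p (Suc c)}"
  using assms unfolding uncoloured_def
  by (fastforce simp: le_Suc_eq)

text \<open>
  The uncoloured rows in increasing order, reconstructed from the numbers \<open>w c\<close> of white
  cells. One row more than the white cells is kept: the last row of the list is the one with
  the 1.
\<close>

fun open_rows :: "(nat \<Rightarrow> nat) \<Rightarrow> (nat \<Rightarrow> nat) \<Rightarrow> nat \<Rightarrow> nat list" where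
  "open_rows h w 0 = take (Suc (w 0)) [0..<h 0]"
| "open_rows h w (Suc c) = take (Suc (w (Suc c))) (open_rows h w c @ [h c..<h (Suc c)])"

lemma initial_segment:
  fixes xs :: "nat list"
  assumes "sorted_wrt (<) xs" "i < length xs"
  shows "{r \<in> set xs. r \<le> xs ! i} = set (take (Suc i) xs)"
proof -
  have "xs ! j \<le> xs ! i \<longleftrightarrow> j \<le> i" if "j < length xs" for j
    using sorted_wrt_nth_less[OF assms(1), of i j] sorted_wrt_nth_less[OF assms(1), of j i]
      that assms(2) by (cases j i rule: linorder_cases) auto
  then have "{r \<in> set xs. r \<le> xs ! i} = (!) xs ` {..i}"
    using assms(2) by (auto simp: in_set_conv_nth) (use le_less_trans in blast)
  also have "\<dots> = set (take (Suc i) xs)"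
    using assms(2) by (simp add: nth_image[symmetric] atLeast0AtMost[symmetric] atLeastLessThanSuc_atLeastAtMost)
  finally show ?thesis .
qed

lemma initial_segment_card:
  fixes xs :: "nat list"
  assumes "sorted_wrt (<) xs" "p \<in> set xs"
    and "card {r \<in> set xs. r \<le> p} = Suc w"
  shows "set (take (Suc w) xs) = {r \<in> set xs. r \<le> p} \<and> last (take (Suc w) xs) = p"
proof -
  obtain i where i: "i < length xs" "xs ! i = p"
    using assms(2) by (auto simp: in_set_conv_nth)
  have "{r \<in> set xs. r \<le> p} = set (take (Suc i) xs)"
    using initial_segment[OF assms(1) i(1)] i(2) by simp
  moreover from this have "i = w"
    using assms(1,3) i(1) by (simp add: distinct_card strict_sorted_iff)
  ultimately show ?thesis using i by (simp add: take_Suc_conv_app_nth)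
qed

lemma open_rows_strict:
  assumes "\<And>i j. i \<le> j \<Longrightarrow> j < C \<Longrightarrow> h i \<le> h j" "c < C"
  shows "sorted_wrt (<) (open_rows h w c) \<and> set (open_rows h w c) \<subseteq> {..<h c}"
  using assms(2)
proof (induction c)
  case 0
  then show ?case
    using set_take_subset[of "Suc (w 0)" "[0..<h 0]"] by (auto simp: sorted_wrt_take simp del: take_upt)
next
  case (Suc c)
  let ?V = "open_rows h w c @ [h c..<h (Suc c)]"
  have "sorted_wrt (<) ?V" "set ?V \<subseteq> {..<h (Suc c)}"
    using Suc assms(1)[of c "Suc c"] by (fastforce simp: sorted_wrt_append)+
  then show ?case
    using set_take_subset[of "Suc (w (Suc c))" ?V] by (auto simp: sorted_wrt_take simp del: take_append)
qed

text \<open>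
  By induction, the rows available in a column are known from the previous column; the
  uncoloured ones among them form the initial segment ending in \<open>p c\<close>, and the number of
  white cells fixes its length.
\<close>

lemma open_rows_unique:
  assumes mono: "\<And>i j. i \<le> j \<Longrightarrow> j < C \<Longrightarrow> h i \<le> h j"
    and adm: "admissible C h p"
    and w: "\<And>c. c < C \<Longrightarrow> card (uncoloured h p c) = Suc (w c)"
    and "c < C"
  shows "set (open_rows h w c) = uncoloured h p c \<and> last (open_rows h w c) = p c"
  using \<open>c < C\<close>
proof (induction c)
  case 0
  then show ?case
    using initial_segment_card[of "[0..<h 0]" "p 0" "w 0"] w[of 0] mem_uncoloured[OF adm, of 0]
    by (simp add: uncoloured_0 del: take_upt)
next
  case (Suc c)
  let ?V = "open_rows h w c @ [h c..<h (Suc c)]"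
  have V: "set ?V = uncoloured h p c \<union> {h c..<h (Suc c)}" using Suc by simp
  have U: "uncoloured h p (Suc c) = {r \<in> set ?V. r \<le> p (Suc c)}"
    unfolding V using Suc.prems by (intro uncoloured_Suc mono) auto
  have "sorted_wrt (<) ?V"
    using open_rows_strict[of C h c w] mono Suc.prems by (fastforce simp: sorted_wrt_append)
  moreover have "p (Suc c) \<in> set ?V"
    using mem_uncoloured[OF adm Suc.prems] U by blast
  ultimately show ?case
    using initial_segment_card[of ?V "p (Suc c)" "w (Suc c)"] w[OF Suc.prems] U
    by (simp del: take_append)
qed

text \<open>
  This inequality makes the drawn edges weakly increasing in height.
\<close>

lemma card_uncoloured_Suc:
  assumes mono: "\<And>i j. i \<le> j \<Longrightarrow> j < C \<Longrightarrow> h i \<le> h j" and "Suc c < C"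
  shows "card (uncoloured h p (Suc c)) + h c \<le> card (uncoloured h p c) + h (Suc c)"
proof -
  have "uncoloured h p (Suc c) \<subseteq> uncoloured h p c \<union> {h c..<h (Suc c)}"
    using uncoloured_Suc[of h c p] assms by auto
  then have "card (uncoloured h p (Suc c)) \<le> card (uncoloured h p c \<union> {h c..<h (Suc c)})"
    by (intro card_mono) auto
  also have "\<dots> \<le> card (uncoloured h p c) + (h (Suc c) - h c)"
    using card_Un_le[of "uncoloured h p c" "{h c..<h (Suc c)}"] by simp
  finally show ?thesis using mono[of c "Suc c"] assms(2) by simp
qed

lemma card_uncoloured_le: "card (uncoloured h p c) \<le> h c"
  using card_mono[of "{..<h c}" "uncoloured h p c"] by (auto simp: uncoloured_def)

text \<open>
  The hypothesis \<open>step\<close> says that there are always enough available rows for an initial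
  segment of size \<open>w c + 1\<close>. Putting the 1 on the last row of this segment keeps it
  uncoloured, so condition (ii) holds.
\<close>

lemma open_rows_exist:
  assumes mono: "\<And>i j. i \<le> j \<Longrightarrow> j < C \<Longrightarrow> h i \<le> h j"
    and le: "\<And>c. c < C \<Longrightarrow> w c < h c"
    and step: "\<And>c. Suc c < C \<Longrightarrow> h c - w c \<le> h (Suc c) - w (Suc c)"
  defines "p \<equiv> \<lambda>c. last (open_rows h w c)"
  shows "admissible C h p \<and> (\<forall>c < C. card (uncoloured h p c) = Suc (w c))"
proof -
  have len: "length (open_rows h w c) = Suc (w c)" if "c < C" for c
    using that
  proof (induction c)
    case (Suc c)
    then show ?case using le[of "Suc c"] le[of c] step[of c] mono[of c "Suc c"] by simp
  next
    case 0
    then show ?case using le[of 0] by simp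
  qed
  have last_take: "{r \<in> set V. r \<le> last (take (Suc m) V)} = set (take (Suc m) V)"
    if "sorted_wrt (<) V" "length (take (Suc m) V) = Suc m" for V :: "nat list" and m
    using initial_segment[OF that(1), of m] that(2) by (simp add: take_Suc_conv_app_nth)
  have U: "uncoloured h p c = set (open_rows h w c)" if "c < C" for c
    using that
  proof (induction c)
    case 0
    then show ?case
      using last_take[of "[0..<h 0]" "w 0"] len[OF 0] by (simp add: uncoloured_0 p_def del: take_upt)
  next
    case (Suc c)
    let ?V = "open_rows h w c @ [h c..<h (Suc c)]"
    have "sorted_wrt (<) ?V"
      using open_rows_strict[of C h c w] mono Suc.prems by (fastforce simp: sorted_wrt_append)
    moreover have "uncoloured h p (Suc c) = {r \<in> set ?V. r \<le> p (Suc c)}"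
      using uncoloured_Suc[of h c p] mono Suc by simp
    ultimately show ?case
      using last_take[of ?V "w (Suc c)"] len[OF Suc.prems] by (simp add: p_def del: take_append)
  qed
  have mem: "p c \<in> uncoloured h p c" if "c < C" for c
    using U[OF that] len[OF that] unfolding p_def by (metis Zero_not_Suc last_in_set list.size(3))
  then have "admissible C h p"
    unfolding admissible_def uncoloured_def by (auto simp: less_imp_le)
  moreover have "card (uncoloured h p c) = Suc (w c)" if "c < C" for c
    using U[OF that] len[OF that] open_rows_strict[of C h c w] mono that
    by (simp add: distinct_card strict_sorted_iff)
  ultimately show ?thesis by blast
qed

section \<open>Catalan tableaux as profiles with rows of ones\<close>

text \<open>
  The shape is read off from \<open>North # \<omega>\<close> because the profile lacks the first step of the
  border. The heights of the columns are taken at starting height 1 for the same reason.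
\<close>

definition tableau_of :: "path \<Rightarrow> (nat \<Rightarrow> nat) \<Rightarrow> tableau" where
  "tableau_of \<omega> p = \<lparr>ncols = count_list \<omega> East, shape = rows (North # \<omega>),
     filling = (\<lambda>(c, r). if c < count_list \<omega> East \<and> r < tops 1 \<omega> ! c
                          then if r = p c then 1 else 0 else undefined)\<rparr>"

abbreviation adm :: "path \<Rightarrow> (nat \<Rightarrow> nat) \<Rightarrow> bool" where
  "adm \<omega> p \<equiv> admissible (count_list \<omega> East) ((!) (tops 1 \<omega>)) p"

lemma mono_tops:
  "i \<le> j \<Longrightarrow> j < count_list s East \<Longrightarrow> tops y s ! i \<le> tops y s ! j"
  using sorted_nth_mono[OF sorted_tops] by (simp add: length_tops)

lemma ncols_tableau_of [simp]: "ncols (tableau_of \<omega> p) = count_list \<omega> East"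
  by (simp add: tableau_of_def)

lemma cells_tableau_of:
  "(c, r) \<in> cells (tableau_of \<omega> p) \<longleftrightarrow> c < count_list \<omega> East \<and> r < tops 1 \<omega> ! c"
  using less_tops_iff[of c "North # \<omega>" 0 r] by (auto simp: cells_def tableau_of_def)

lemma filling_tableau_of:
  assumes "c < count_list \<omega> East" "r < tops 1 \<omega> ! c"
  shows "filling (tableau_of \<omega> p) (c, r) = (if r = p c then 1 else 0)"
  using assms by (simp add: tableau_of_def)

lemma one_tableau_of:
  "has_entry (tableau_of \<omega> p) 1 (c, r) \<longleftrightarrow>
     c < count_list \<omega> East \<and> r < tops 1 \<omega> ! c \<and> r = p c"
  by (auto simp: has_entry_def cells_tableau_of filling_tableau_of cong: conj_cong)

lemma zero_tableau_of:
  "has_entry (tableau_of \<omega> p) 0 (c, r) \<longleftrightarrow>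
     c < count_list \<omega> East \<and> r < tops 1 \<omega> ! c \<and> r \<noteq> p c"
  by (auto simp: has_entry_def cells_tableau_of filling_tableau_of cong: conj_cong)

lemma profile_tableau_of: "profile (tableau_of \<omega> p) = \<omega>"
  using nw_border_rows[of "North # \<omega>"] by (simp add: profile_def tableau_of_def)

lemma tableau_of_in_catalan_tableaux:
  assumes "adm \<omega> p"
  shows "tableau_of \<omega> p \<in> catalan_tableaux (length \<omega> + 1)"
proof -
  let ?T = "tableau_of \<omega> p"
  have "sorted_wrt (\<ge>) (shape ?T)" "\<forall>l \<in> set (shape ?T). l \<le> ncols ?T"
    using sorted_rows[of "North # \<omega>"] rows_le[of _ "North # \<omega>"] by (auto simp: tableau_of_def)
  moreover have "filling ?T \<in> cells ?T \<rightarrow>\<^sub>E {0, 1}"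
  proof
    show "filling ?T x \<in> {0, 1}" if "x \<in> cells ?T" for x
      using that by (cases x) (auto simp: cells_tableau_of, auto simp: tableau_of_def)
    show "filling ?T x = undefined" if "x \<notin> cells ?T" for x
      using that by (cases x) (auto simp: cells_tableau_of, auto simp: tableau_of_def)
  qed
  moreover have "\<forall>c < ncols ?T. \<exists>!r. has_entry ?T 1 (c, r)"
    using assms unfolding one_tableau_of admissible_def by auto
  moreover have "\<not> (\<exists>c r. has_entry ?T 0 (c, r) \<and>
      (\<exists>r' < r. has_entry ?T 1 (c, r')) \<and> (\<exists>c' > c. has_entry ?T 1 (c', r)))"
    unfolding one_tableau_of zero_tableau_of
  proof clarify
    fix c c'
    assume "c < c'" "c' < count_list \<omega> East" "p c < p c'" "p c' < tops 1 \<omega> ! c"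
    with assms have "p c' \<le> p c \<or> tops 1 \<omega> ! c \<le> p c'" unfolding admissible_def by blast
    with \<open>p c < p c'\<close> \<open>p c' < tops 1 \<omega> ! c\<close> show False by simp
  qed
  moreover have "length (shape ?T) + ncols ?T = length \<omega> + 1"
    using length_rows[of "North # \<omega>"] by (simp add: tableau_of_def)
  ultimately show ?thesis
    unfolding catalan_tableaux_def catalan_tableau_def mem_Collect_eq by (intro conjI)
qed

text \<open>
  The bottom row of the shape is full: the 1 of the leftmost column lies in a row which meets all
  columns, and the bottom row is at least as long. Hence the border starts with North and the
  profile determines the shape.
\<close>

lemma catalan_tableau_is_tableau_of:
  assumes "T \<in> catalan_tableaux (n + 1)"
  shows "\<exists>\<omega> p. length \<omega> = n \<and> adm \<omega> p \<and> T = tableau_of \<omega> p"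
proof -
  let ?C = "ncols T"
  have "catalan_tableau T" and size: "length (shape T) + ?C = n + 1"
    using assms unfolding catalan_tableaux_def by auto
  then have sort: "sorted_wrt (\<ge>) (shape T)" and le: "\<forall>l \<in> set (shape T). l \<le> ?C"
    and fill: "filling T \<in> cells T \<rightarrow>\<^sub>E {0, 1}"
    and one: "\<forall>c < ?C. \<exists>!r. has_entry T 1 (c, r)"
    and avoid: "\<not> (\<exists>c r. has_entry T 0 (c, r) \<and>
      (\<exists>r' < r. has_entry T 1 (c, r')) \<and> (\<exists>c' > c. has_entry T 1 (c', r)))"
    unfolding catalan_tableau_def by simp_all
  obtain ls where shape: "shape T = ?C # ls"
  proof (cases "?C = 0")
    case True
    with size obtain l ls where "shape T = l # ls" by (cases "shape T") auto
    with True le that show ?thesis by simp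
  next
    case False
    then obtain r where "(0, r) \<in> cells T" using one unfolding has_entry_def by blast
    then have r: "r < length (shape T)" "?C \<le> shape T ! r" unfolding cells_def by auto
    then obtain l ls where l: "shape T = l # ls" by (cases "shape T") auto
    have "shape T ! r \<le> l" using r(1) sort l by (cases r) auto
    with r(2) le l that show ?thesis by simp
  qed
  define \<omega> where "\<omega> = nw_border ?C ls"
  have border: "nw_border ?C (shape T) = North # \<omega>" by (simp add: shape \<omega>_def)
  then have C: "count_list \<omega> East = ?C" and rows: "rows (North # \<omega>) = shape T"
    using rows_nw_border[OF sort, of ?C] le by auto
  have len: "length \<omega> = n"
    using length_rows[of "North # \<omega>"] C size unfolding rows by simp
  define p where "p = (\<lambda>c. THE r. has_entry T 1 (c, r))"
  have p: "has_entry T 1 (c, r) \<longleftrightarrow> r = p c" if "c < ?C" for c r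
    using one that theI'[of "\<lambda>r. has_entry T 1 (c, r)"] unfolding p_def by blast
  have cells: "(c, r) \<in> cells T \<longleftrightarrow> c < ?C \<and> r < tops 1 \<omega> ! c" for c r
    using less_tops_iff[of c "North # \<omega>" 0 r] C unfolding rows by (auto simp: cells_def)
  have bound: "p c < tops 1 \<omega> ! c" if "c < ?C" for c
    using p[OF that, of "p c"] cells unfolding has_entry_def by blast
  have zero: "has_entry T 0 (c, r) \<longleftrightarrow> r < tops 1 \<omega> ! c \<and> r \<noteq> p c" if "c < ?C" for c r
    using p[OF that, of r] cells[of c r] that fill unfolding has_entry_def by fastforce
  have "adm \<omega> p"
    unfolding admissible_def C
  proof (intro conjI allI impI)
    fix c c' assume c: "c < c'" "c' < ?C"
    have "has_entry T 1 (c, p c)" "has_entry T 1 (c', p c')"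
      using p[of c] p[of c'] c by simp_all
    then have "\<not> (has_entry T 0 (c, p c') \<and> p c < p c')"
      using avoid c(1) by blast
    then show "p c' \<le> p c \<or> tops 1 \<omega> ! c \<le> p c'"
      using zero[of c "p c'"] c by (auto simp: not_less)
  qed (rule bound)
  moreover have "filling T x = filling (tableau_of \<omega> p) x" for x
  proof (cases x)
    case (Pair c r)
    show ?thesis
    proof (cases "(c, r) \<in> cells T")
      case True
      then show ?thesis
        using p[of c r] zero[of c r] cells[of c r] C Pair
        by (cases "r = p c") (auto simp: has_entry_def filling_tableau_of)
    next
      case False
      then have "filling T (c, r) = undefined" using fill by (simp add: PiE_def extensional_def)
      then show ?thesis using False cells[of c r] C Pair by (auto simp: tableau_of_def)
    qed
  qed
  then have "T = tableau_of \<omega> p"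
    using C rows by (intro tableau.equality) (auto simp: tableau_of_def)
  ultimately show ?thesis using len by blast
qed

text \<open>
  By condition (ii) the 1 of the column is uncoloured; the other uncoloured cells are the white
  ones.
\<close>

lemma card_uncoloured:
  assumes "adm \<omega> p" "c < count_list \<omega> East"
  shows "card (uncoloured ((!) (tops 1 \<omega>)) p c) = Suc (num_white (tableau_of \<omega> p) c)"
proof -
  let ?U = "uncoloured ((!) (tops 1 \<omega>)) p c"
  have col: "(c, r) \<in> coloured_cells (tableau_of \<omega> p) \<longleftrightarrow>
      r < tops 1 \<omega> ! c \<and> (\<exists>c' \<le> c. r < tops 1 \<omega> ! c' \<and> p c' < r)" for r
    using assms(2) unfolding coloured_cells_def one_tableau_of cells_tableau_of
    by (auto intro: less_trans)
  have "{r. (c, r) \<in> white_cells (tableau_of \<omega> p)} = ?U - {p c}"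
    using assms(2) unfolding white_cells_def mem_Collect_eq zero_tableau_of col uncoloured_def
    by (auto simp: not_less)
  then have "Suc (num_white (tableau_of \<omega> p) c) = Suc (card (?U - {p c}))"
    by (simp add: num_white_def)
  also have "\<dots> = card ?U"
    using mem_uncoloured[OF assms] by (intro card_Suc_Diff1) auto
  finally show ?thesis by simp
qed

lemma num_white_less:
  assumes "adm \<omega> p" "c < count_list \<omega> East"
  shows "num_white (tableau_of \<omega> p) c < tops 1 \<omega> ! c"
  using card_uncoloured_le[of "(!) (tops 1 \<omega>)" p c] card_uncoloured[OF assms] by simp

section \<open>The lower path\<close>

lemma graph_eq_shifted_graph:
  fixes f w h :: "nat \<Rightarrow> nat"
  shows "{(0 + i, f i) | i. i < k} = {(c, y). c < k \<and> y + w c = h c} \<longleftrightarrow>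
    (\<forall>c < k. f c + w c = h c)" (is "?G = ?S \<longleftrightarrow> ?R")
proof
  assume "?G = ?S"
  then have "(c, f c) \<in> ?S" if "c < k" for c using that by auto
  then show ?R by simp
next
  assume R: ?R
  have "(c, y) \<in> ?S \<longleftrightarrow> c < k \<and> y = f c" for c y
    using R[rule_format, of c] by auto
  then show "?G = ?S" by auto
qed

text \<open>
  Being a path through the drawn edges is a condition on the tops of \<open>\<eta>\<close>, which it
  determines completely: \<open>h c - w c\<close> for the columns, then the height of the common end.
\<close>

lemma joins_drawn_edges_iff:
  "joins_drawn_edges (tableau_of \<omega> p) \<eta> \<longleftrightarrow>
     count_list \<eta> East = count_list \<omega> East \<and> last (tops 1 \<eta>) = last (tops 1 \<omega>) \<and>
     (\<forall>c < count_list \<omega> East.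
        tops 1 \<eta> ! c + num_white (tableau_of \<omega> p) c = tops 1 \<omega> ! c)"
proof -
  have drawn: "drawn_edges (tableau_of \<omega> p) = {(c, y). c < count_list \<omega> East \<and>
      y + num_white (tableau_of \<omega> p) c = tops 1 \<omega> ! c}"
    unfolding drawn_edges_def profile_tableau_of east_edges_eq by auto
  show ?thesis
    unfolding joins_drawn_edges_def profile_tableau_of path_end_eq drawn east_edges_eq
    using graph_eq_shifted_graph[of "(!) (tops 1 \<eta>)" "count_list \<omega> East"
        "num_white (tableau_of \<omega> p)" "(!) (tops 1 \<omega>)"]
    by (cases "count_list \<eta> East = count_list \<omega> East") simp_all
qed

lemma path_eqI:
  assumes "count_list \<eta> East = count_list \<eta>' East" "last (tops y \<eta>) = last (tops y \<eta>')"
    and "\<And>c. c < count_list \<eta> East \<Longrightarrow> tops y \<eta> ! c = tops y \<eta>' ! c"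
  shows "\<eta> = \<eta>'"
proof (rule tops_inj)
  show "tops y \<eta> = tops y \<eta>'"
    using assms by (intro nth_equalityI) (auto simp: length_tops last_conv_nth less_Suc_eq)
qed

lemma ex1_joins_drawn_edges:
  assumes "adm \<omega> p"
  shows "\<exists>!\<eta>. joins_drawn_edges (tableau_of \<omega> p) \<eta>"
proof (rule ex_ex1I)
  let ?w = "num_white (tableau_of \<omega> p)" and ?h = "(!) (tops 1 \<omega>)"
  let ?C = "count_list \<omega> East" and ?e = "last (tops 1 \<omega>)"
  define ts where "ts = map (\<lambda>c. ?h c - ?w c) [0..<?C] @ [?e]"
  have less: "?w c < ?h c" if "c < ?C" for c
    using num_white_less[OF assms that] .
  have step: "?h c - ?w c \<le> ?h (Suc c) - ?w (Suc c)" if "Suc c < ?C" for c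
    using card_uncoloured_Suc[of ?C ?h c p] mono_tops[of _ _ \<omega> 1] that less[of c]
      card_uncoloured[OF assms, of c] card_uncoloured[OF assms, of "Suc c"] by simp
  have "sorted (map (\<lambda>c. ?h c - ?w c) [0..<?C])"
    unfolding sorted_iff_nth_Suc using step by simp
  moreover have "?h c - ?w c \<le> ?e" if "c < ?C" for c
    using sorted_nth_mono[OF sorted_tops, of c ?C 1 \<omega>] that
    by (simp add: length_tops last_conv_nth)
  ultimately have "sorted ts"
    by (auto simp: ts_def sorted_append)
  moreover have "1 \<le> t" if "t \<in> set ts" for t
    using that less tops_ge[of ?e 1 \<omega>] by (force simp: ts_def)
  ultimately obtain \<eta> where \<eta>: "tops 1 \<eta> = ts"
    using tops_surj[of ts 1] by (auto simp: ts_def)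
  have "count_list \<eta> East = ?C"
    using length_tops[of 1 \<eta>] unfolding \<eta> by (simp add: ts_def)
  then show "\<exists>\<eta>. joins_drawn_edges (tableau_of \<omega> p) \<eta>"
    using less unfolding joins_drawn_edges_iff
    by (intro exI[of _ \<eta>], unfold \<eta>) (auto simp: ts_def nth_append less_imp_le)
next
  fix \<eta> \<eta>'
  assume "joins_drawn_edges (tableau_of \<omega> p) \<eta>" "joins_drawn_edges (tableau_of \<omega> p) \<eta>'"
  then show "\<eta> = \<eta>'"
    unfolding joins_drawn_edges_iff by (intro path_eqI[of _ _ 1]) (auto, metis add_right_cancel)
qed

lemma joins_lower_path:
  assumes "adm \<omega> p"
  shows "joins_drawn_edges (tableau_of \<omega> p) (lower_path (tableau_of \<omega> p))"
  unfolding lower_path_def using ex1_joins_drawn_edges[OF assms] by (rule theI')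

lemma joined_path_in_path_pairs:
  assumes "joins_drawn_edges (tableau_of \<omega> p) \<eta>"
  shows "(\<omega>, \<eta>) \<in> path_pairs (length \<omega>)"
proof -
  have C: "count_list \<eta> East = count_list \<omega> East" and l: "last (tops 1 \<eta>) = last (tops 1 \<omega>)"
    and "\<And>c. c < count_list \<omega> East \<Longrightarrow> tops 1 \<eta> ! c \<le> tops 1 \<omega> ! c"
    using assms unfolding joins_drawn_edges_iff by (simp_all, metis le_add1)
  then have "below \<eta> \<omega>"
    by (subst below_iff_tops) (auto simp: le_less last_conv_nth length_tops)
  moreover have "length \<eta> = length \<omega>"
    using length_path[of \<eta> 1] length_path[of \<omega> 1] C l by simp
  moreover have "last (tops 0 \<eta>) = last (tops 0 \<omega>)"
    using l by (simp add: tops_Suc last_map)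
  ultimately show ?thesis
    using C by (simp add: path_pairs_def path_end_eq)
qed

section \<open>The bijection\<close>

lemma rows_of_ones_unique:
  assumes "adm \<omega> p" "adm \<omega> p'"
    and "\<And>c. c < count_list \<omega> East \<Longrightarrow>
      num_white (tableau_of \<omega> p) c = num_white (tableau_of \<omega> p') c"
    and "c < count_list \<omega> East"
  shows "p c = p' c"
proof -
  have "last (open_rows ((!) (tops 1 \<omega>)) (num_white (tableau_of \<omega> p)) c) = q c"
    if "adm \<omega> q" "\<And>c. c < count_list \<omega> East \<Longrightarrow>
      num_white (tableau_of \<omega> p) c = num_white (tableau_of \<omega> q) c" for q
    using open_rows_unique[OF _ that(1), of "num_white (tableau_of \<omega> p)" c]
      card_uncoloured[OF that(1)] that(2) assms(4) mono_tops[of _ _ \<omega> 1] by simp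
  from this[of p] this[of p'] show ?thesis using assms by simp
qed

lemma tableau_of_cong:
  assumes "\<And>c. c < count_list \<omega> East \<Longrightarrow> p c = p' c"
  shows "tableau_of \<omega> p = tableau_of \<omega> p'"
  using assms by (auto simp: tableau_of_def fun_eq_iff)

lemma inj_on_tableau_to_paths: "inj_on tableau_to_paths (catalan_tableaux (n + 1))"
proof (rule inj_onI)
  fix T T'
  assume "T \<in> catalan_tableaux (n + 1)" "T' \<in> catalan_tableaux (n + 1)"
    and eq: "tableau_to_paths T = tableau_to_paths T'"
  then obtain \<omega> p \<omega>' p' where T: "adm \<omega> p" "T = tableau_of \<omega> p"
    and T': "adm \<omega>' p'" "T' = tableau_of \<omega>' p'"
    using catalan_tableau_is_tableau_of by metis
  have \<omega>: "\<omega>' = \<omega>" and "lower_path T' = lower_path T"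
    using eq T T' by (auto simp: tableau_to_paths_def profile_tableau_of)
  then have "joins_drawn_edges (tableau_of \<omega> p) (lower_path T)"
    "joins_drawn_edges (tableau_of \<omega> p') (lower_path T)"
    using joins_lower_path T T' by metis+
  then have "num_white (tableau_of \<omega> p) c = num_white (tableau_of \<omega> p') c"
    if "c < count_list \<omega> East" for c
    using that unfolding joins_drawn_edges_iff by (metis add_left_cancel)
  then have "p c = p' c" if "c < count_list \<omega> East" for c
    using rows_of_ones_unique T(1) T'(1) \<omega> that by blast
  then show "T = T'"
    using T T' \<omega> tableau_of_cong by blast
qed

text \<open>
  The numbers of white cells are forced to be the vertical distances \<open>w c = h c - g c\<close> of
  the two paths. Then \<open>h c - w c = g c\<close> is weakly increasing since \<open>\<eta>\<close> is a path, so a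
  filling with these numbers exists.
\<close>

lemma path_pair_has_tableau:
  assumes "(\<omega>, \<eta>) \<in> path_pairs n"
  shows "\<exists>p. adm \<omega> p \<and> joins_drawn_edges (tableau_of \<omega> p) \<eta>"
proof -
  let ?C = "count_list \<omega> East" and ?h = "(!) (tops 1 \<omega>)" and ?g = "(!) (tops 1 \<eta>)"
  have C: "count_list \<eta> East = ?C" and l: "last (tops 0 \<eta>) = last (tops 0 \<omega>)"
    and "below \<eta> \<omega>"
    using assms by (auto simp: path_pairs_def path_end_eq)
  then have le: "?g c \<le> ?h c" if "c < ?C" for c
    using that below_iff_tops by simp
  define w where "w c = ?h c - ?g c" for c
  have pos: "1 \<le> ?g c" if "c < ?C" for c
    using that C by (intro tops_ge[of _ 1 \<eta>]) (simp add: length_tops)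
  define p where "p c = last (open_rows ?h w c)" for c
  have p: "adm \<omega> p \<and> (\<forall>c < ?C. card (uncoloured ?h p c) = Suc (w c))"
    unfolding p_def
  proof (rule open_rows_exist)
    show "w c < ?h c" if "c < ?C" for c
      using le[OF that] pos[OF that] by (simp add: w_def)
    show "?h c - w c \<le> ?h (Suc c) - w (Suc c)" if "Suc c < ?C" for c
      using that le[of c] le[of "Suc c"] mono_tops[of c "Suc c" \<eta> 1] C by (simp add: w_def)
  qed (rule mono_tops)
  then have "num_white (tableau_of \<omega> p) c = w c" if "c < ?C" for c
    using that card_uncoloured[of \<omega> p c] by simp
  moreover have "last (tops 1 \<eta>) = last (tops 1 \<omega>)"
    using l by (simp add: tops_Suc last_map)
  ultimately have "joins_drawn_edges (tableau_of \<omega> p) \<eta>"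
    unfolding joins_drawn_edges_iff using C le by (auto simp: w_def)
  with p show ?thesis by blast
qed

theorem mainTheorem4:
  fixes n :: nat
  shows "(\<forall>T \<in> catalan_tableaux (n + 1).
            (\<exists>!\<eta>. joins_drawn_edges T \<eta>) \<and> below (lower_path T) (profile T)) \<and>
         bij_betw tableau_to_paths (catalan_tableaux (n + 1)) (path_pairs n) \<and>
         (\<forall>T \<in> catalan_tableaux (n + 1). fst (tableau_to_paths T) = profile T)"
proof -
  have paths: "(\<exists>!\<eta>. joins_drawn_edges T \<eta>) \<and> tableau_to_paths T \<in> path_pairs n"
    if T: "T \<in> catalan_tableaux (n + 1)" for T
  proof -
    obtain \<omega> p where "length \<omega> = n" "adm \<omega> p" "T = tableau_of \<omega> p"
      using catalan_tableau_is_tableau_of[OF T] by blast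
    then show ?thesis
      using ex1_joins_drawn_edges joined_path_in_path_pairs[OF joins_lower_path]
      by (auto simp: tableau_to_paths_def profile_tableau_of)
  qed
  have "path_pairs n \<subseteq> tableau_to_paths ` catalan_tableaux (n + 1)"
  proof clarify
    fix \<omega> \<eta> assume pair: "(\<omega>, \<eta>) \<in> path_pairs n"
    then obtain p where p: "adm \<omega> p" "joins_drawn_edges (tableau_of \<omega> p) \<eta>"
      using path_pair_has_tableau by blast
    then have "lower_path (tableau_of \<omega> p) = \<eta>"
      using ex1_joins_drawn_edges joins_lower_path by blast
    then have "(\<omega>, \<eta>) = tableau_to_paths (tableau_of \<omega> p)"
      by (simp add: tableau_to_paths_def profile_tableau_of)
    moreover have "tableau_of \<omega> p \<in> catalan_tableaux (n + 1)"
      using tableau_of_in_catalan_tableaux[OF p(1)] pair by (simp add: path_pairs_def)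
    ultimately show "(\<omega>, \<eta>) \<in> tableau_to_paths ` catalan_tableaux (n + 1)" by blast
  qed
  then have "bij_betw tableau_to_paths (catalan_tableaux (n + 1)) (path_pairs n)"
    using paths inj_on_tableau_to_paths by (auto intro: bij_betw_imageI)
  moreover have "below (lower_path T) (profile T)" if "T \<in> catalan_tableaux (n + 1)" for T
    using paths[OF that] by (simp add: tableau_to_paths_def path_pairs_def)
  ultimately show ?thesis
    using paths by (simp add: tableau_to_paths_def)
qed

end
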